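(* Let $X$ be a nonempty set, let $\mathbb{A}$ be a field, let $n\ge 1$ be an integer, and let $f_1,\ldots,f_n:X\to\mathbb{A}$ be functions. Then $f_1,\ldots,f_n$ are linearly independent over $\mathbb{A}$ if and only if there exists $(x_1,\ldots,x_n)\in X^n$ such that the $n\times n$ matrix $\left[f_i(x_j)\right]$ over $\mathbb{A}$ (with entry $f_i(x_j)$ in row $i$, column $j$) is nonsingular.
   Context: Functions $f_1,\ldots,f_n:X\to\mathbb{A}$ are linearly independent if, for $\alpha_1,\ldots,\alpha_n\in\mathbb{A}$, the identity $\sum_{i=1}^n\alpha_i f_i=0$ (as a function on $X$) implies $\alpha_1=\ldots=\alpha_n=0$. *)

theory Defs
  imports "Jordan_Normal_Form.Matrix" "HOL-Library.FuncSet"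
begin

(* Linear independence of the finite family f 0, ..., f (n - 1) of functions on X.
   It is a property of the family, not of its set of values: a repeated function
   makes the family dependent.  Values of the functions outside X play no role. *)
definition lin_indep_on :: "'x set \<Rightarrow> nat \<Rightarrow> (nat \<Rightarrow> 'x \<Rightarrow> 'a::field) \<Rightarrow> bool" where
  "lin_indep_on X n f \<longleftrightarrow>
     (\<forall>\<alpha> :: nat \<Rightarrow> 'a. (\<forall>x\<in>X. (\<Sum>i<n. \<alpha> i * f i x) = 0) \<longrightarrow> (\<forall>i<n. \<alpha> i = 0))"

end

theory Submission
  imports Defs "Jordan_Normal_Form.Determinant"
begin

text \<open>
  Nonsingularity of the matrix of values is expressed by its determinant.  If this determinant is
  nonzero for some sample points, then a vanishing combination of the functions, evaluated at these
  points, is a vanishing combination of the rows of the matrix, so its coefficients are zero.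

  Conversely, the sample points of an independent family are found one at a time, in step with the
  functions (lemma \<open>extend_nonsingular_sample\<close>).  Suppose that
  \<open>x 0, \<dots>, x (n - 1)\<close> already make the determinant for \<open>f 0, \<dots>, f (n - 1)\<close> nonzero, and let the
  next point \<open>y\<close> vary.  Expanding the determinant of size \<open>n + 1\<close> along its last column, the only
  one that contains \<open>y\<close>, writes it as a linear combination of \<open>f 0 y, \<dots>, f n y\<close> whose coefficients
  do not depend on \<open>y\<close>.  The coefficient of \<open>f n y\<close> is the determinant of size \<open>n\<close>, hence
  nonzero, so independence of \<open>f 0, \<dots>, f n\<close> forbids that the combination vanishes at every \<open>y\<close>
  in \<open>X\<close>.
\<close>

abbreviation sample_mat :: "nat \<Rightarrow> (nat \<Rightarrow> 'x \<Rightarrow> 'a) \<Rightarrow> (nat \<Rightarrow> 'x) \<Rightarrow> 'a::field mat" where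
  "sample_mat n f x \<equiv> mat n n (\<lambda>(i, j). f i (x j))"

lemma invertible_mat_iff_det_nonzero:
  fixes A :: "'a::field mat"
  assumes A: "A \<in> carrier_mat n n"
  shows "invertible_mat A \<longleftrightarrow> det A \<noteq> 0"
proof
  assume "invertible_mat A"
  then obtain B where AB: "A * B = 1\<^sub>m n" and BA: "B * A = 1\<^sub>m (dim_row B)"
    using A by (auto simp: invertible_mat_def inverts_mat_def)
  have "dim_col B = n" using arg_cong[OF AB, of dim_col] by simp
  moreover have "dim_row B = n" using arg_cong[OF BA, of dim_col] A by simp
  ultimately have "B \<in> carrier_mat n n" by auto
  then have "det A * det B = 1" using det_mult[OF A, of B] AB by simp
  then show "det A \<noteq> 0" by auto
next
  assume "det A \<noteq> 0"
  from det_non_zero_imp_unit[OF A this, of "()"]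
  obtain B where "B \<in> carrier_mat n n" "B * A = 1\<^sub>m n" "A * B = 1\<^sub>m n"
    by (auto simp: Units_def ring_mat_def)
  with A show "invertible_mat A"
    by (auto simp: invertible_mat_def inverts_mat_def)
qed

lemma lin_indep_on_Suc_imp:
  assumes "lin_indep_on X (Suc n) f"
  shows "lin_indep_on X n f"
  unfolding lin_indep_on_def
proof (intro allI impI)
  fix \<alpha> i
  assume comb: "\<forall>x\<in>X. (\<Sum>i<n. \<alpha> i * f i x) = 0" and "i < n"
  have "\<forall>x\<in>X. (\<Sum>i<Suc n. (\<alpha>(n := 0)) i * f i x) = 0" using comb by simp
  then have "\<forall>i<Suc n. (\<alpha>(n := 0)) i = 0"
    using assms unfolding lin_indep_on_def by blast
  with \<open>i < n\<close> show "\<alpha> i = 0" by (metis fun_upd_other less_Suc_eq less_irrefl)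
qed

text \<open>
  A cofactor along the last column is computed after deleting that column, so it depends only on the
  first \<open>n\<close> sample points.
\<close>

lemma det_sample_mat_last_column:
  "det (sample_mat (Suc n) f (x(n := y))) =
     (\<Sum>i<Suc n. cofactor (sample_mat (Suc n) f x) i n * f i y)"
proof -
  let ?M = "sample_mat (Suc n) f (x(n := y))"
  have "cofactor ?M i n = cofactor (sample_mat (Suc n) f x) i n" for i
    unfolding cofactor_def mat_delete_def
    by (intro arg_cong2[of _ _ _ _ "(*)"] refl arg_cong[of _ _ det] cong_mat) auto
  then show ?thesis
    using laplace_expansion_column[of ?M "Suc n" n]
    by (simp add: mult.commute)
qed

lemma cofactor_sample_mat_corner:
  "cofactor (sample_mat (Suc n) f x) n n = det (sample_mat n f x)"
  unfolding cofactor_def mat_delete_def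
  by (auto intro!: arg_cong[of _ _ det] cong_mat)

lemma extend_nonsingular_sample:
  assumes indep: "lin_indep_on X (Suc n) f"
    and det: "det (sample_mat n f x) \<noteq> 0"
  obtains y where "y \<in> X" and "det (sample_mat (Suc n) f (x(n := y))) \<noteq> 0"
proof -
  let ?c = "\<lambda>i. cofactor (sample_mat (Suc n) f x) i n"
  have "?c n \<noteq> 0" using det by (simp add: cofactor_sample_mat_corner)
  then have "\<not> (\<forall>i<Suc n. ?c i = 0)" by blast
  then have "\<not> (\<forall>y\<in>X. (\<Sum>i<Suc n. ?c i * f i y) = 0)"
    using indep[unfolded lin_indep_on_def, THEN spec, of ?c] by blast
  then show thesis
    using that unfolding det_sample_mat_last_column by blast
qed

text \<open>
  The induction starts with the empty family, whose matrix of values has size zero and determinant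
  one.
\<close>

lemma lin_indep_on_imp_nonsingular_sample:
  assumes "lin_indep_on X n f"
  shows "\<exists>x \<in> {..<n} \<rightarrow>\<^sub>E X. det (sample_mat n f x) \<noteq> 0"
  using assms
proof (induction n)
  case 0
  then show ?case by simp
next
  case (Suc n)
  then obtain x where x: "x \<in> {..<n} \<rightarrow>\<^sub>E X" "det (sample_mat n f x) \<noteq> 0"
    using lin_indep_on_Suc_imp by blast
  then obtain y where y: "y \<in> X" "det (sample_mat (Suc n) f (x(n := y))) \<noteq> 0"
    using extend_nonsingular_sample[OF Suc.prems] by blast
  have "x(n := y) \<in> {..<Suc n} \<rightarrow>\<^sub>E X"
    using x(1) y(1) by (simp add: lessThan_Suc PiE_fun_upd)
  with y(2) show ?case by blast
qed

lemma nonsingular_sample_imp_lin_indep_on: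
  assumes x: "x \<in> {..<n} \<rightarrow> X" and det: "det (sample_mat n f x) \<noteq> 0"
  shows "lin_indep_on X n f"
  unfolding lin_indep_on_def
proof (intro allI impI)
  fix \<alpha> i
  assume comb: "\<forall>x\<in>X. (\<Sum>i<n. \<alpha> i * f i x) = 0" and "i < n"
  \<comment> \<open>A combination of the rows is a product of the transposed matrix with a vector.\<close>
  let ?T = "transpose_mat (sample_mat n f x)"
  have T: "?T \<in> carrier_mat n n" by simp
  have "(\<Sum>k<n. f k (x j) * \<alpha> k) = 0" if "j < n" for j
    using comb x that by (force simp: mult.commute)
  then have "?T *\<^sub>v vec n \<alpha> = 0\<^sub>v n"
    by (intro eq_vecI) (auto simp: scalar_prod_def lessThan_atLeast0)
  moreover have "det ?T \<noteq> 0" using det by (simp add: det_transpose[of _ n])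
  ultimately have "vec n \<alpha> = 0\<^sub>v n"
    using det_0_iff_vec_prod_zero_field[OF T] vec_carrier[of n \<alpha>] by blast
  with \<open>i < n\<close> show "\<alpha> i = 0" by (metis index_vec index_zero_vec(1))
qed

theorem theorem2:
  fixes X :: "'x set" and n :: nat and f :: "nat \<Rightarrow> 'x \<Rightarrow> 'a::field"
  assumes "X \<noteq> {}" and "n \<ge> 1"
  shows "lin_indep_on X n f \<longleftrightarrow>
    (\<exists>x \<in> {..<n} \<rightarrow>\<^sub>E X. invertible_mat (mat n n (\<lambda>(i, j). f i (x j))))"
proof -
  have "invertible_mat (sample_mat n f x) \<longleftrightarrow> det (sample_mat n f x) \<noteq> 0" for x
    by (rule invertible_mat_iff_det_nonzero[of _ n]) simp
  then show ?thesis
    using lin_indep_on_imp_nonsingular_sample[of X n f]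
      nonsingular_sample_imp_lin_indep_on[of _ n X f]
    by (auto simp: PiE_def)
qed

end
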